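(* For every integer $k \geq 1$, the polynomial $B_{k}(x,x,\ldots,x)$ (all $2k$ variables set equal to $x$) is equal to the $2k$-th Fibonacci polynomial $F_{2k}(x)$.
   Context: Let $\sigma_{1} = \begin{pmatrix} 0 & 1 \\ 1 & 0 \end{pmatrix}$, $\sigma_{2} = \begin{pmatrix} 0 & -\sqrt{-1} \\ \sqrt{-1} & 0 \end{pmatrix}$, $\sigma_{3} = \begin{pmatrix} 1 & 0 \\ 0 & -1 \end{pmatrix}$ be the Pauli matrices; together with the identity $I$ they form a basis of the complex $2\times 2$ matrices. Put $M(x,y) = \begin{pmatrix} 1+xy & x \\ y & 1 \end{pmatrix}$ and, for $k\ge 1$, $M(x_{1},y_{1},\ldots,x_{k},y_{k}) = M(x_{1},y_{1})\cdots M(x_{k},y_{k})$. The polynomials $A_k,B_k,C_k,D_k$ in $x_1,y_1,\ldots,x_k,y_k$ (with complex coefficients) are defined by $$M(x_{1},y_{1},\ldots,x_{k},y_{k}) = A_{k} I + B_{k} \sigma_{1} + C_{k} \sigma_{2} + D_{k} \sigma_{3}.$$ The Fibonacci polynomials are defined by $F_{0}(x)=0$, $F_{1}(x)=1$ and $F_{k+1}(x) = xF_{k}(x)+F_{k-1}(x)$ for $k\ge 1$. *)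

theory Defs
  imports
    "HOL-Analysis.Analysis"
    "HOL-Library.Poly_Mapping"
    "HOL-Computational_Algebra.Polynomial"
begin

text \<open>
  Polynomials over the complex numbers in the indeterminates \<open>x\<^sub>1, y\<^sub>1, x\<^sub>2, y\<^sub>2, \<dots>\<close>: finitely
  supported functions from monomials (finitely supported exponent functions) to coefficients.
  Their multiplication is the convolution product of \<open>Poly_Mapping\<close>.
\<close>

datatype indet = X nat | Y nat

type_synonym xy_poly = "(indet \<Rightarrow>\<^sub>0 nat) \<Rightarrow>\<^sub>0 complex"

definition Var :: "indet \<Rightarrow> xy_poly" where
  "Var v = Poly_Mapping.single (Poly_Mapping.single v 1) 1"

definition Const :: "complex \<Rightarrow> xy_poly" where
  "Const c = Poly_Mapping.single 0 c"

definition subst_poly :: "(indet \<Rightarrow> complex poly) \<Rightarrow> xy_poly \<Rightarrow> complex poly" where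
  "subst_poly f p =
     (\<Sum>m\<in>Poly_Mapping.keys p. smult (Poly_Mapping.lookup p m)
        (\<Prod>v\<in>Poly_Mapping.keys m. f v ^ Poly_Mapping.lookup m v))"

definition pauli1 :: "complex^2^2" where
  "pauli1 = vector [vector [0, 1], vector [1, 0]]"

definition pauli2 :: "complex^2^2" where
  "pauli2 = vector [vector [0, - \<i>], vector [\<i>, 0]]"

definition pauli3 :: "complex^2^2" where
  "pauli3 = vector [vector [1, 0], vector [0, - 1]]"

definition M :: "xy_poly \<Rightarrow> xy_poly \<Rightarrow> xy_poly^2^2" where
  "M x y = vector [vector [1 + x * y, x], vector [y, 1]]"

primrec M_prod :: "nat \<Rightarrow> xy_poly^2^2" where
  "M_prod 0 = mat 1"
| "M_prod (Suc k) = M_prod k ** M (Var (X (Suc k))) (Var (Y (Suc k)))"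

definition pauli_comb :: "xy_poly \<times> xy_poly \<times> xy_poly \<times> xy_poly \<Rightarrow> xy_poly^2^2" where
  "pauli_comb = (\<lambda>(a, b, c, d).
     map_matrix ((*) a) (mat 1) +
     map_matrix ((*) b) (map_matrix Const pauli1) +
     map_matrix ((*) c) (map_matrix Const pauli2) +
     map_matrix ((*) d) (map_matrix Const pauli3))"

lemma Const_simps: "Const 0 = 0" "Const 1 = 1" "Const (- c) = - Const c"
  "Const (a * b) = Const a * Const b" "Const (a + b) = Const a + Const b"
  by (simp_all add: Const_def single_uminus mult_single single_add)

lemma pauli_comb_eq_iff:
  "N = pauli_comb (a, b, c, d) \<longleftrightarrow>
     N $ 1 $ 1 = a + d \<and> N $ 1 $ 2 = b - c * Const \<i> \<and>
     N $ 2 $ 1 = b + c * Const \<i> \<and> N $ 2 $ 2 = a - d"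
  by (auto simp: pauli_comb_def pauli1_def pauli2_def pauli3_def vec_eq_iff forall_2
      map_matrix_def mat_def Const_simps)

text \<open>
  The Pauli matrices and the identity are a basis of the \<open>2 \<times> 2\<close> matrices over the polynomial
  ring, so the descriptions of the coordinates below are well-defined.
\<close>

lemma ex1_pauli_comb: "\<exists>!q. N = pauli_comb q"
proof -
  define h where "h = Const (1/2)"
  define i where "i = Const \<i>"
  have h: "h + h = 1"
    by (simp add: h_def flip: Const_simps)
  have i: "i * i = - 1"
    by (simp add: i_def flip: Const_simps)
  have half: "h * (p + p) = p" for p :: xy_poly
  proof -
    have "h * (p + p) = (h + h) * p" by (simp only: algebra_simps)
    then show ?thesis by (simp add: h)
  qed
  have iff: "p = b - c * i \<and> q = b + c * i \<longleftrightarrow> b = h * (p + q) \<and> c = h * (i * (p - q))"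
    for p q b c :: xy_poly
  proof (intro iffI)
    assume pq: "p = b - c * i \<and> q = b + c * i"
    then have "p - q = - (i * (c + c))" by (simp add: algebra_simps)
    then have "i * (p - q) = i * - (i * (c + c))" by (rule arg_cong)
    also have "\<dots> = - (i * i) * (c + c)" by (simp only: mult.assoc mult_minus_left mult_minus_right)
    finally have "i * (p - q) = - (i * i) * (c + c)" .
    then have "i * (p - q) = c + c" by (simp add: i)
    moreover have "p + q = b + b" using pq by simp
    ultimately show "b = h * (p + q) \<and> c = h * (i * (p - q))" by (simp only: half)
  next
    assume bc: "b = h * (p + q) \<and> c = h * (i * (p - q))"
    have "c * i = (i * i) * (h * (p - q))" using bc by (simp only: mult_ac)
    then have ci: "c * i = h * (q - p)" by (simp add: i algebra_simps)
    have "b - c * i = h * (p + p)" "b + c * i = h * (q + q)"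
      using bc unfolding ci by (simp_all add: algebra_simps)
    then show "p = b - c * i \<and> q = b + c * i" by (simp only: half)
  qed
  have iff': "p = a + d \<and> q = a - d \<longleftrightarrow> a = h * (p + q) \<and> d = h * (p - q)"
    for p q a d :: xy_poly
  proof (intro iffI)
    assume pq: "p = a + d \<and> q = a - d"
    then have "p + q = a + a" "p - q = d + d" by simp_all
    then show "a = h * (p + q) \<and> d = h * (p - q)" by (simp only: half)
  next
    assume ad: "a = h * (p + q) \<and> d = h * (p - q)"
    then have "a + d = h * (p + p)" "a - d = h * (q + q)" by (simp_all add: algebra_simps)
    then show "p = a + d \<and> q = a - d" by (simp only: half)
  qed
  have "N = pauli_comb (a, b, c, d) \<longleftrightarrow>
      a = h * (N$1$1 + N$2$2) \<and> b = h * (N$1$2 + N$2$1) \<and>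
      c = h * (i * (N$1$2 - N$2$1)) \<and> d = h * (N$1$1 - N$2$2)" for a b c d
    unfolding pauli_comb_eq_iff i_def[symmetric]
    using iff[of "N$1$2" b c "N$2$1"] iff'[of "N$1$1" a d "N$2$2"] by blast
  then show ?thesis
    by (intro ex1I[of _ "(h * (N$1$1 + N$2$2), h * (N$1$2 + N$2$1),
      h * (i * (N$1$2 - N$2$1)), h * (N$1$1 - N$2$2))"]) auto
qed

definition A_poly :: "nat \<Rightarrow> xy_poly" where
  "A_poly k = (THE a. \<exists>b c d. M_prod k = pauli_comb (a, b, c, d))"

definition B_poly :: "nat \<Rightarrow> xy_poly" where
  "B_poly k = (THE b. \<exists>a c d. M_prod k = pauli_comb (a, b, c, d))"

definition C_poly :: "nat \<Rightarrow> xy_poly" where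
  "C_poly k = (THE c. \<exists>a b d. M_prod k = pauli_comb (a, b, c, d))"

definition D_poly :: "nat \<Rightarrow> xy_poly" where
  "D_poly k = (THE d. \<exists>a b c. M_prod k = pauli_comb (a, b, c, d))"

lemma M_prod_pauli_comb: "M_prod k = pauli_comb (A_poly k, B_poly k, C_poly k, D_poly k)"
proof -
  obtain a b c d where q: "M_prod k = pauli_comb (a, b, c, d)"
    using ex1_pauli_comb[of "M_prod k"] by (metis prod.exhaust)
  have uniq: "a' = a \<and> b' = b \<and> c' = c \<and> d' = d"
    if "M_prod k = pauli_comb (a', b', c', d')" for a' b' c' d'
    using ex1_pauli_comb[of "M_prod k"] q that by blast
  have "A_poly k = a" "B_poly k = b" "C_poly k = c" "D_poly k = d"
    unfolding A_poly_def B_poly_def C_poly_def D_poly_def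
    using q uniq by (auto intro!: the_equality)
  with q show ?thesis by simp
qed

fun fib_poly :: "nat \<Rightarrow> complex poly" where
  "fib_poly 0 = 0"
| "fib_poly (Suc 0) = 1"
| "fib_poly (Suc (Suc n)) = [:0, 1:] * fib_poly (Suc n) + fib_poly n"

end

theory Submission
  imports Defs
begin

text \<open>
  Substituting \<open>x\<close> for all variables is a ring homomorphism and sends each factor to
  \<open>M(x,x)\<close>, the square of the Fibonacci matrix with rows \<open>(x, 1)\<close> and \<open>(1, 0)\<close>.  Hence both
  off-diagonal entries of the product become \<open>F\<^bsub>2k\<^esub>(x)\<close>, while their sum is \<open>2 B\<^sub>k\<close>.
\<close>

definition subst_monom :: "(indet \<Rightarrow> complex poly) \<Rightarrow> (indet \<Rightarrow>\<^sub>0 nat) \<Rightarrow> complex poly" where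
  "subst_monom f m = (\<Prod>v\<in>Poly_Mapping.keys m. f v ^ Poly_Mapping.lookup m v)"

text \<open>Exponents outside the support are 0 and contribute factors 1. Enlarging the index set
  lets \<open>m\<close>, \<open>n\<close> and \<open>m + n\<close> share one product.\<close>

lemma subst_monom_superset:
  assumes "finite S" "Poly_Mapping.keys m \<subseteq> S"
  shows "subst_monom f m = (\<Prod>v\<in>S. f v ^ Poly_Mapping.lookup m v)"
  unfolding subst_monom_def using assms
  by (intro prod.mono_neutral_left) (auto simp: in_keys_iff)

lemma subst_monom_add: "subst_monom f (m + n) = subst_monom f m * subst_monom f n"
proof -
  let ?S = "Poly_Mapping.keys m \<union> Poly_Mapping.keys n"
  have "Poly_Mapping.keys (m + n) \<subseteq> ?S"
    by (rule Poly_Mapping.keys_add)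
  then show ?thesis
    by (simp add: subst_monom_superset[of ?S] lookup_add power_add prod.distrib)
qed

text \<open>Coefficients outside the support vanish. A common index set is needed for sums, since
  cancellation can shrink the support of \<open>p + q\<close>.\<close>

lemma subst_poly_superset:
  assumes "finite S" "Poly_Mapping.keys p \<subseteq> S"
  shows "subst_poly f p = (\<Sum>m\<in>S. smult (Poly_Mapping.lookup p m) (subst_monom f m))"
  unfolding subst_poly_def subst_monom_def[symmetric] using assms
  by (intro sum.mono_neutral_left) (auto simp: in_keys_iff)

lemma subst_poly_add: "subst_poly f (p + q) = subst_poly f p + subst_poly f q"
proof -
  let ?S = "Poly_Mapping.keys p \<union> Poly_Mapping.keys q"
  have "Poly_Mapping.keys (p + q) \<subseteq> ?S"
    by (rule Poly_Mapping.keys_add)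
  then show ?thesis
    by (simp add: subst_poly_superset[of ?S] lookup_add smult_add_left sum.distrib)
qed

lemma subst_poly_0: "subst_poly f 0 = 0"
  by (simp add: subst_poly_def)

lemma subst_poly_single:
  "subst_poly f (Poly_Mapping.single m c) = smult c (subst_monom f m)"
  by (simp add: subst_poly_superset[of "{m}"])

lemma subst_poly_1: "subst_poly f 1 = 1"
  by (simp add: subst_poly_single subst_monom_def flip: single_one)

lemma subst_poly_Var: "subst_poly f (Var v) = f v"
  by (simp add: Var_def subst_poly_single subst_monom_def)

lemma subst_poly_sum: "subst_poly f (sum g S) = (\<Sum>i\<in>S. subst_poly f (g i))"
  by (induction S rule: infinite_finite_induct) (simp_all add: subst_poly_0 subst_poly_add)

lemma xy_poly_sum_single:
  fixes p :: xy_poly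
  shows "(\<Sum>m\<in>Poly_Mapping.keys p. Poly_Mapping.single m (Poly_Mapping.lookup p m)) = p"
  by (rule poly_mapping_eqI)
     (simp add: lookup_sum lookup_single when_def in_keys_iff)

text \<open>Expanding both factors into single terms reduces the claim, by additivity, to products
  of single terms, where coefficients multiply and exponents add.\<close>

lemma subst_poly_mult: "subst_poly f (p * q) = subst_poly f p * subst_poly f q"
proof -
  let ?s = "\<lambda>p m. Poly_Mapping.single m (Poly_Mapping.lookup p m)"
  have "p * q = (\<Sum>m\<in>Poly_Mapping.keys p. \<Sum>n\<in>Poly_Mapping.keys q. ?s p m * ?s q n)"
    by (simp add: xy_poly_sum_single flip: sum_product)
  also have "subst_poly f \<dots> = (\<Sum>m\<in>Poly_Mapping.keys p. \<Sum>n\<in>Poly_Mapping.keys q.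
      smult (Poly_Mapping.lookup p m) (subst_monom f m) *
      smult (Poly_Mapping.lookup q n) (subst_monom f n))"
    by (simp add: subst_poly_sum mult_single subst_poly_single subst_monom_add mult_ac)
  also have "\<dots> = subst_poly f p * subst_poly f q"
    by (simp only: subst_poly_def sum_product flip: subst_monom_def)
  finally show ?thesis .
qed

text \<open>The last entry is \<open>F\<^bsub>2k-1\<^esub>\<close>, written so that \<open>2 * k - 1\<close> is not truncated at \<open>k = 0\<close>.\<close>

lemma subst_M_prod:
  fixes k :: nat
  defines "e \<equiv> \<lambda>i j. subst_poly (\<lambda>_. [:0, 1:]) (M_prod k $ i $ j)"
  shows "e 1 1 = fib_poly (Suc (2 * k))" "e 1 2 = fib_poly (2 * k)"
    "e 2 1 = fib_poly (2 * k)" "[:0, 1:] * fib_poly (2 * k) + e 2 2 = fib_poly (Suc (2 * k))"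
  unfolding e_def
proof (induction k)
  case 0
  {
    case 1 show ?case by (simp add: mat_def subst_poly_1)
  next
    case 2 show ?case by (simp add: mat_def subst_poly_0)
  next
    case 3 show ?case by (simp add: mat_def subst_poly_0)
  next
    case 4 show ?case by (simp add: mat_def subst_poly_1)
  }
next
  case (Suc k)
  define x :: "complex poly" where "x = [:0, 1:]"
  let ?h = "subst_poly (\<lambda>_. x)"
  \<comment> \<open>Right multiplication by \<open>M\<close> acts on each row separately, so one
    computation serves both values of \<open>i\<close>.\<close>
  have row: "?h (M_prod (Suc k) $ i $ 1) = ?h (M_prod k $ i $ 1) * (1 + x * x) + ?h (M_prod k $ i $ 2) * x"
    "?h (M_prod (Suc k) $ i $ 2) = ?h (M_prod k $ i $ 1) * x + ?h (M_prod k $ i $ 2)" for i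
    by (simp_all add: matrix_matrix_mult_def M_def sum_2 subst_poly_add subst_poly_mult
        subst_poly_Var subst_poly_1)
  have fib: "fib_poly (2 * Suc k) = x * fib_poly (Suc (2 * k)) + fib_poly (2 * k)"
    "fib_poly (Suc (2 * Suc k)) = x * fib_poly (2 * Suc k) + fib_poly (Suc (2 * k))"
    by (simp_all add: x_def del: mult_pCons_left mult_pCons_right)
  note IH = Suc.IH[folded x_def]
  \<comment> \<open>The fourth claim is solved for the entry so that it can be substituted in the
    second row.\<close>
  have e22: "?h (M_prod k $ 2 $ 2) = fib_poly (Suc (2 * k)) - x * fib_poly (2 * k)"
    using IH(4) by (simp add: algebra_simps)
  {
    case 1 show ?case unfolding x_def[symmetric] row fib using IH by (simp add: algebra_simps)
  next
    case 2 show ?case unfolding x_def[symmetric] row fib using IH by (simp add: algebra_simps)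
  next
    case 3 show ?case unfolding x_def[symmetric] row fib e22 using IH by (simp add: algebra_simps)
  next
    case 4 show ?case unfolding x_def[symmetric] row fib e22 using IH by (simp add: algebra_simps)
  }
qed

theorem theorem2p2:
  fixes k :: nat
  assumes "k \<ge> 1"
  shows "subst_poly (\<lambda>_. [:0, 1:]) (B_poly k) = fib_poly (2 * k)"
proof -
  let ?h = "subst_poly (\<lambda>_. [:0, 1:])"
  \<comment> \<open>The off-diagonal entries are \<open>B_poly k\<close> minus and plus
    \<open>C_poly k * Const \<i>\<close>, so their sum eliminates \<open>C_poly k\<close>.\<close>
  have "B_poly k + B_poly k = M_prod k $ 1 $ 2 + M_prod k $ 2 $ 1"
    using M_prod_pauli_comb[of k] by (simp add: pauli_comb_eq_iff)
  then have "?h (B_poly k) + ?h (B_poly k) = fib_poly (2 * k) + fib_poly (2 * k)"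
    by (metis subst_poly_add subst_M_prod(2,3))
  \<comment> \<open>As a product, the nonzero factor 2 can be cancelled in the integral domain of
    complex polynomials.\<close>
  then have "2 * ?h (B_poly k) = 2 * fib_poly (2 * k)"
    by (simp only: mult_2)
  then show ?thesis by simp
qed

end
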